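(* Let $S\subset\mathbb{R}^3$ be the unit sphere with geodesic distance $d$, and let $A_1=(1,0,0)$, $A_2=(0,1,0)$, $A_3=(0,0,1)$. Let $w_1,w_2,w_3>0$ be weights attached to $A_1,A_2,A_3$, and let $A_0$ be the weighted Fermat-Torricelli point of $\triangle A_1A_2A_3$ for these weights (an interior point of the triangle). For $i=1,2,3$ let $A_i'$ be a point of the geodesic arc $A_0A_i$, carrying the same weight $w_i$, such that the sides of the geodesic triangle $\triangle A_1'A_2'A_3'$ have lengths less than $\frac{\pi}{2}$ and the floating-case inequalities hold for $\triangle A_1'A_2'A_3'$ with weights $w_1,w_2,w_3$. Let $A_0'$ be the weighted Fermat-Torricelli point of $\triangle A_1'A_2'A_3'$, so that $A_0'\equiv A_0$ lies in the interior of $\triangle A_1'A_2'A_3'$. Put $a_{0i}=d(A_0,A_i)$, $a_{ij}'=d(A_i',A_j')$, $a=d(A_1,A_1')$, $b=d(A_2,A_2')$, $c=d(A_3,A_3')$. Then $a,b,c$ necessarily satisfy the system $$\cos a_{12}'=\cos(a_{01}-a)\cos(a_{02}-b)+\sin(a_{01}-a)\sin(a_{02}-b)\,\frac{w_3^2-w_1^2-w_2^2}{2w_1w_2},$$ $$\cos a_{23}'=\cos(a_{02}-b)\cos(a_{03}-c)+\sin(a_{02}-b)\sin(a_{03}-c)\,\frac{w_1^2-w_2^2-w_3^2}{2w_2w_3},$$ $$\cos a_{13}'=\cos(a_{01}-a)\cos(a_{03}-c)+\sin(a_{01}-a)\sin(a_{03}-c)\,\frac{w_2^2-w_1^2-w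_3^2}{2w_1w_3}.$$
   Context: For a geodesic triangle $\triangle B_1B_2B_3$ on the unit sphere $S$ with positive weights $w_1,w_2,w_3$ at $B_1,B_2,B_3$, the weighted Fermat point is the point minimizing $P\mapsto\sum_{i=1}^3 w_i\,d(P,B_i)$; it is called the weighted Fermat-Torricelli point when it is an interior point of the triangle (not on any of the sides). Let $\vec U_{B_iB_j}$ denote the unit tangent vector at $B_i$ of the geodesic arc $B_iB_j$. The floating-case inequalities for $\triangle B_1B_2B_3$ are: $\|w_j\vec U_{B_iB_j}+w_k\vec U_{B_iB_k}\|>w_i$ for every $i$, where $\{i,j,k\}=\{1,2,3\}$. Geodesic arcs are shortest arcs of great circles. *)

theory Defs
  imports "HOL-Analysis.Analysis"
begin

abbreviation S2 :: "(real^3) set" where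
  "S2 \<equiv> sphere 0 1"

definition geodist :: "real^3 \<Rightarrow> real^3 \<Rightarrow> real" where
  "geodist P Q = arccos (P \<bullet> Q)"

text \<open>The plane sector spanned by two non-antipodal unit vectors cuts the sphere in the shorter
  great-circle arc between them.\<close>
definition geodesic_arc :: "real^3 \<Rightarrow> real^3 \<Rightarrow> (real^3) set" where
  "geodesic_arc P Q = {s *\<^sub>R P + t *\<^sub>R Q | s t. 0 \<le> s \<and> 0 \<le> t} \<inter> S2"

text \<open>Three points of the sphere that do not lie on a common great circle.\<close>
definition geodesic_triangle :: "real^3 \<Rightarrow> real^3 \<Rightarrow> real^3 \<Rightarrow> bool" where
  "geodesic_triangle B1 B2 B3 \<longleftrightarrow> {B1, B2, B3} \<subseteq> S2 \<and>
     \<not> (\<exists>n. n \<noteq> 0 \<and> n \<bullet> B1 = 0 \<and> n \<bullet> B2 = 0 \<and> n \<bullet> B3 = 0)"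

definition triangle_region :: "real^3 \<Rightarrow> real^3 \<Rightarrow> real^3 \<Rightarrow> (real^3) set" where
  "triangle_region B1 B2 B3 =
     {r *\<^sub>R B1 + s *\<^sub>R B2 + t *\<^sub>R B3 | r s t. 0 \<le> r \<and> 0 \<le> s \<and> 0 \<le> t} \<inter> S2"

definition triangle_interior :: "real^3 \<Rightarrow> real^3 \<Rightarrow> real^3 \<Rightarrow> (real^3) set" where
  "triangle_interior B1 B2 B3 = triangle_region B1 B2 B3 -
     (geodesic_arc B1 B2 \<union> geodesic_arc B2 B3 \<union> geodesic_arc B1 B3)"

text \<open>The minimum is taken over the whole sphere.\<close>
definition weighted_Fermat_point ::
    "real \<Rightarrow> real \<Rightarrow> real \<Rightarrow> real^3 \<Rightarrow> real^3 \<Rightarrow> real^3 \<Rightarrow> real^3 \<Rightarrow> bool" where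
  "weighted_Fermat_point w1 w2 w3 B1 B2 B3 =
     is_arg_min (\<lambda>P. w1 * geodist P B1 + w2 * geodist P B2 + w3 * geodist P B3) (\<lambda>P. P \<in> S2)"

definition weighted_Fermat_Torricelli_point ::
    "real \<Rightarrow> real \<Rightarrow> real \<Rightarrow> real^3 \<Rightarrow> real^3 \<Rightarrow> real^3 \<Rightarrow> real^3 \<Rightarrow> bool" where
  "weighted_Fermat_Torricelli_point w1 w2 w3 B1 B2 B3 P \<longleftrightarrow>
     weighted_Fermat_point w1 w2 w3 B1 B2 B3 P \<and> P \<in> triangle_interior B1 B2 B3"

text \<open>Unit tangent vector at \<open>P\<close> of the geodesic arc from \<open>P\<close> to \<open>Q\<close>: the normalised component of
  \<open>Q\<close> orthogonal to \<open>P\<close> (\<open>sgn x\<close> is \<open>x\<close> divided by its norm). It is 0 if \<open>Q\<close> is \<open>P\<close> or \<open>-P\<close>.\<close>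
definition unit_tangent :: "real^3 \<Rightarrow> real^3 \<Rightarrow> real^3" where
  "unit_tangent P Q = sgn (Q - (P \<bullet> Q) *\<^sub>R P)"

definition floating_case ::
    "real \<Rightarrow> real \<Rightarrow> real \<Rightarrow> real^3 \<Rightarrow> real^3 \<Rightarrow> real^3 \<Rightarrow> bool" where
  "floating_case w1 w2 w3 B1 B2 B3 \<longleftrightarrow>
     norm (w2 *\<^sub>R unit_tangent B1 B2 + w3 *\<^sub>R unit_tangent B1 B3) > w1 \<and>
     norm (w1 *\<^sub>R unit_tangent B2 B1 + w3 *\<^sub>R unit_tangent B2 B3) > w2 \<and>
     norm (w1 *\<^sub>R unit_tangent B3 B1 + w2 *\<^sub>R unit_tangent B3 B2) > w3"

end

theory Submission imports Defs begin

text \<open>Moving the vertices towards \<open>A0\<close> decreases the objective at \<open>A0\<close> by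
  \<open>\<Sum> w\<^sub>i d(A\<^sub>i, A\<^sub>i')\<close> and, by the triangle inequality, by at most that much anywhere
  else, so \<open>A0\<close> stays a minimiser. Another minimiser \<open>P\<close> must realise equality in these triangle
  inequalities, so it lies on the great circles \<open>A0 A\<^sub>i\<close> for which \<open>A\<^sub>i' \<noteq> A\<^sub>i\<close>; there are at
  least two of these because the new sides are shorter than \<open>\<pi>/2\<close>, hence \<open>P = A0\<close> or \<open>P = -A0\<close>.
  The formulas are the spherical law of cosines at \<open>A0\<close>, where the first-order condition
  \<open>\<Sum> w\<^sub>i U\<^sub>i = 0\<close> determines the angles between the unit tangents \<open>U\<^sub>i\<close>.\<close>

section \<open>Distances and unit tangents on the sphere\<close>

lemma S2_dot_self: "P \<in> S2 \<Longrightarrow> P \<bullet> P = 1"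
  by (simp add: dot_square_norm)

lemma S2_abs_dot_le: "P \<in> S2 \<Longrightarrow> Q \<in> S2 \<Longrightarrow> \<bar>P \<bullet> Q\<bar> \<le> 1"
  using Cauchy_Schwarz_ineq2[of P Q] by simp

lemma geodist_commute: "geodist P Q = geodist Q P"
  by (simp add: geodist_def inner_commute)

lemma cos_geodist: "P \<in> S2 \<Longrightarrow> Q \<in> S2 \<Longrightarrow> cos (geodist P Q) = P \<bullet> Q"
  unfolding geodist_def by (rule cos_arccos_abs) (rule S2_abs_dot_le)

lemma sin_geodist: "P \<in> S2 \<Longrightarrow> Q \<in> S2 \<Longrightarrow> sin (geodist P Q) = sqrt (1 - (P \<bullet> Q)\<^sup>2)"
  unfolding geodist_def by (rule sin_arccos_abs) (rule S2_abs_dot_le)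

lemma geodist_bounds:
  assumes "P \<in> S2" "Q \<in> S2"
  shows "0 \<le> geodist P Q" "geodist P Q \<le> pi"
  using S2_abs_dot_le[OF assms] unfolding geodist_def
  by (auto intro!: arccos_lbound arccos_ubound)

lemma sin_geodist_nonneg: "P \<in> S2 \<Longrightarrow> Q \<in> S2 \<Longrightarrow> 0 \<le> sin (geodist P Q)"
  using geodist_bounds[of P Q] by (intro sin_ge_zero)

text \<open>Undoes the normalisation in \<open>unit_tangent\<close>: the component of
  \<open>Q\<close> orthogonal to \<open>P\<close> has squared norm
  \<open>1 - (P \<bullet> Q)\<^sup>2\<close>, the squared sine of the distance. For
  \<open>Q = P\<close> or \<open>Q = -P\<close> both sides vanish.\<close>

lemma unit_tangent_polar:
  assumes "P \<in> S2" "Q \<in> S2"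
  shows "sin (geodist P Q) *\<^sub>R unit_tangent P Q = Q - (P \<bullet> Q) *\<^sub>R P"
proof -
  let ?v = "Q - (P \<bullet> Q) *\<^sub>R P"
  have "?v \<bullet> ?v = 1 - (P \<bullet> Q)\<^sup>2"
    using assms[THEN S2_dot_self]
    by (simp add: inner_diff_left inner_diff_right inner_commute power2_eq_square algebra_simps)
  then have "norm ?v = sin (geodist P Q)"
    using assms by (simp add: sin_geodist norm_eq_sqrt_inner)
  moreover have "norm x *\<^sub>R sgn x = x" for x :: "real^3"
    by (cases "x = 0") (simp_all add: sgn_div_norm)
  ultimately show ?thesis
    unfolding unit_tangent_def by metis
qed

lemma unit_tangent_orthogonal: "P \<in> S2 \<Longrightarrow> P \<bullet> unit_tangent P Q = 0"
  using S2_dot_self[of P]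
  by (simp add: unit_tangent_def sgn_div_norm inner_diff_right)

lemma norm_unit_tangent_le: "norm (unit_tangent P Q) \<le> 1"
  by (simp add: unit_tangent_def norm_sgn)

lemma norm_unit_tangent:
  assumes "P \<in> S2" "Q \<in> S2" "\<bar>P \<bullet> Q\<bar> < 1"
  shows "norm (unit_tangent P Q) = 1"
proof -
  have "(P \<bullet> Q)\<^sup>2 < 1"
    using assms(3) by (simp add: abs_square_less_1)
  then have "sin (geodist P Q) \<noteq> 0"
    using assms by (simp add: sin_geodist)
  \<comment> \<open>Otherwise \<open>Q\<close> would be \<open>(P \<bullet> Q) *\<^sub>R P\<close>,
    and the inner product with \<open>Q\<close> would give
    \<open>1 = (P \<bullet> Q)\<^sup>2\<close>.\<close>
  then have "Q - (P \<bullet> Q) *\<^sub>R P \<noteq> 0"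
    using unit_tangent_polar[OF assms(1,2)] assms unfolding unit_tangent_def
    by (metis S2_dot_self \<open>(P \<bullet> Q)\<^sup>2 < 1\<close> eq_iff_diff_eq_0 inner_commute inner_scaleR_left
        less_irrefl power2_eq_square)
  then show ?thesis
    by (simp add: unit_tangent_def norm_sgn)
qed

section \<open>Spherical law of cosines and the triangle inequality\<close>

text \<open>Inner product of the polar forms of \<open>X\<close> and \<open>Z\<close> around
  \<open>Y\<close>; the inner product of the two tangents plays the role of the cosine of the angle
  at \<open>Y\<close>.\<close>

lemma spherical_law_of_cosines:
  assumes "X \<in> S2" "Y \<in> S2" "Z \<in> S2"
  shows "X \<bullet> Z = cos (geodist Y X) * cos (geodist Y Z)
    + sin (geodist Y X) * sin (geodist Y Z) * (unit_tangent Y X \<bullet> unit_tangent Y Z)"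
proof -
  have "sin (geodist Y X) * sin (geodist Y Z) * (unit_tangent Y X \<bullet> unit_tangent Y Z)
      = (X - (Y \<bullet> X) *\<^sub>R Y) \<bullet> (Z - (Y \<bullet> Z) *\<^sub>R Y)"
    using assms by (simp flip: unit_tangent_polar)
  also have "\<dots> = X \<bullet> Z - (Y \<bullet> X) * (Y \<bullet> Z)"
    using S2_dot_self[OF assms(2)]
    by (simp add: inner_diff_left inner_diff_right inner_commute algebra_simps)
  finally show ?thesis
    using assms by (simp add: cos_geodist)
qed

text \<open>The angle at \<open>Y\<close> has cosine at least -1, so the law of cosines bounds
  \<open>cos (geodist X Z)\<close> below by the cosine of the sum, and cos decreases on
  \<open>{0..pi}\<close>. A sum above \<open>pi\<close> exceeds every distance.\<close>

lemma geodist_triangle: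
  assumes "X \<in> S2" "Y \<in> S2" "Z \<in> S2"
  shows "geodist X Z \<le> geodist X Y + geodist Y Z"
proof (cases "geodist X Y + geodist Y Z \<le> pi")
  case True
  have "\<bar>unit_tangent Y X \<bullet> unit_tangent Y Z\<bar> \<le> norm (unit_tangent Y X) * norm (unit_tangent Y Z)"
    by (rule Cauchy_Schwarz_ineq2)
  also have "\<dots> \<le> 1"
    using mult_mono[OF norm_unit_tangent_le[of Y X] norm_unit_tangent_le[of Y Z]] by simp
  finally have "sin (geodist Y X) * sin (geodist Y Z) * (- 1)
      \<le> sin (geodist Y X) * sin (geodist Y Z) * (unit_tangent Y X \<bullet> unit_tangent Y Z)"
    using assms by (intro mult_left_mono mult_nonneg_nonneg sin_geodist_nonneg) auto
  then have "cos (geodist X Y + geodist Y Z) \<le> cos (geodist X Z)"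
    using spherical_law_of_cosines[OF assms] cos_geodist[OF assms(1,3)]
    by (simp add: cos_add geodist_commute)
  then show ?thesis
    using True geodist_bounds assms by (subst (asm) cos_mono_le_eq) (auto intro: add_nonneg_nonneg)
next
  case False
  then show ?thesis
    using geodist_bounds(2)[OF assms(1,3)] by linarith
qed

text \<open>Equality in the law of cosines leaves only an angle \<open>pi\<close> at
  \<open>Y\<close> or \<open>X = Y\<close> or \<open>X = -Y\<close>; in each case \<open>X\<close>
  lies on the great circle through \<open>Y\<close> and \<open>Z\<close>, which \<open>ndeg\<close>
  makes unique.\<close>

lemma geodist_triangle_equality:
  assumes "X \<in> S2" "Y \<in> S2" "Z \<in> S2"
    and eq: "geodist X Z = geodist X Y + geodist Y Z"
    and ndeg: "\<bar>Y \<bullet> Z\<bar> < 1"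
  shows "\<exists>s t. X = s *\<^sub>R Y + t *\<^sub>R Z"
proof -
  let ?U = "unit_tangent Y X" and ?V = "unit_tangent Y Z"
  have V: "norm ?V = 1"
    using norm_unit_tangent assms by blast
  have "(Y \<bullet> Z)\<^sup>2 < 1"
    using ndeg by (simp add: abs_square_less_1)
  then have s: "sin (geodist Y Z) \<noteq> 0"
    using assms by (simp add: sin_geodist)
  have "X \<bullet> Z = cos (geodist Y X + geodist Y Z)"
    using eq cos_geodist[OF assms(1,3)] by (simp add: geodist_commute)
  then have "sin (geodist Y X) * sin (geodist Y Z) * (?U \<bullet> ?V + 1) = 0"
    using spherical_law_of_cosines[OF assms(1-3)] by (simp add: cos_add algebra_simps)
  then consider "sin (geodist Y X) = 0" | "?U \<bullet> ?V = -1"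
    using s by (auto simp: add_eq_0_iff)
  then obtain k where k: "sin (geodist Y X) *\<^sub>R ?U = k *\<^sub>R ?V"
  proof cases
    case 1
    then show ?thesis
      using that[of 0] by simp
  next
    case 2
    have "?U \<bullet> ?U \<le> 1" "?V \<bullet> ?V = 1"
      using norm_unit_tangent_le[of Y X] V by (simp_all add: dot_square_norm power_le_one)
    \<comment> \<open>Vectors of norm at most 1 with inner product -1 are opposite: the squared norm
      of their sum is at most 1 + 1 - 2.\<close>
    then have "(?U + ?V) \<bullet> (?U + ?V) \<le> 0"
      using 2 by (simp add: inner_add_left inner_add_right inner_commute)
    then have "(?U + ?V) \<bullet> (?U + ?V) = 0"
      using inner_ge_zero[of "?U + ?V"] by linarith
    then have "?U + ?V = 0"
      by simp
    then have "?U = - ?V"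
      by (simp add: eq_neg_iff_add_eq_0)
    then show ?thesis
      using that[of "- sin (geodist Y X)"] by simp
  qed
  define l where "l = k / sin (geodist Y Z)"
  have "k *\<^sub>R ?V = l *\<^sub>R (sin (geodist Y Z) *\<^sub>R ?V)"
    using s by (simp add: l_def)
  then have "X - (Y \<bullet> X) *\<^sub>R Y = l *\<^sub>R (Z - (Y \<bullet> Z) *\<^sub>R Y)"
    using k unit_tangent_polar assms by metis
  then have "X = (Y \<bullet> X - l * (Y \<bullet> Z)) *\<^sub>R Y + l *\<^sub>R Z"
    by (simp add: algebra_simps)
  then show ?thesis
    by blast
qed

section \<open>Points on geodesic arcs\<close>

text \<open>In the coordinates \<open>s\<close>, \<open>t\<close> of \<open>Y\<close> both sides
  have the same cosine. The bound \<open>0 \<le> X \<bullet> Z\<close> keeps both partial distances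
  at most \<open>pi / 2\<close>, so their sum stays where cos is injective.\<close>

lemma geodesic_arc_geodist_add:
  assumes "X \<in> S2" "Z \<in> S2" "0 \<le> X \<bullet> Z" "Y \<in> geodesic_arc X Z"
  shows "geodist X Z = geodist X Y + geodist Y Z"
proof -
  obtain s t where st: "0 \<le> s" "0 \<le> t" and Y: "Y = s *\<^sub>R X + t *\<^sub>R Z" and YS: "Y \<in> S2"
    using assms(4) by (auto simp: geodesic_arc_def)
  define c where "c = X \<bullet> Z"
  have XX: "X \<bullet> X = 1" and ZZ: "Z \<bullet> Z = 1"
    using assms S2_dot_self by auto
  have XY: "X \<bullet> Y = s + t * c" and YZ: "Y \<bullet> Z = s * c + t"
    by (simp_all add: Y inner_add_left inner_add_right XX ZZ c_def)
  have "Y \<bullet> Y = s\<^sup>2 + t\<^sup>2 + 2 * s * t * c"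
    by (simp add: Y inner_add_left inner_add_right XX ZZ c_def inner_commute power2_eq_square
        algebra_simps)
  then have one: "s\<^sup>2 + t\<^sup>2 + 2 * s * t * c = 1"
    using S2_dot_self[OF YS] by simp
  have "1 - (s + t * c)\<^sup>2 = t\<^sup>2 * (1 - c\<^sup>2)" "1 - (s * c + t)\<^sup>2 = s\<^sup>2 * (1 - c\<^sup>2)"
    using one by algebra+
  then have sins: "sin (geodist X Y) = t * sqrt (1 - c\<^sup>2)" "sin (geodist Y Z) = s * sqrt (1 - c\<^sup>2)"
    using assms YS st by (simp_all add: sin_geodist XY YZ real_sqrt_mult)
  have "c\<^sup>2 \<le> 1"
    using S2_abs_dot_le[OF assms(1,2)] by (simp add: c_def abs_square_le_1)
  then have sq: "sqrt (1 - c\<^sup>2) * sqrt (1 - c\<^sup>2) = 1 - c\<^sup>2"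
    by simp
  have "cos (geodist X Y + geodist Y Z)
      = (s + t * c) * (s * c + t) - s * t * (sqrt (1 - c\<^sup>2) * sqrt (1 - c\<^sup>2))"
    using assms YS by (simp add: cos_add cos_geodist XY YZ sins)
  also have "\<dots> = c * (s\<^sup>2 + t\<^sup>2 + 2 * s * t * c)"
    unfolding sq by (simp add: power2_eq_square algebra_simps)
  finally have "cos (geodist X Y + geodist Y Z) = cos (geodist X Z)"
    using assms one by (simp add: cos_geodist c_def)
  moreover have "0 \<le> X \<bullet> Y" "0 \<le> Y \<bullet> Z"
    using st assms(3) unfolding XY YZ by (simp_all add: c_def)
  then have "geodist X Y \<le> pi / 2" "geodist Y Z \<le> pi / 2"
    using S2_abs_dot_le[OF assms(1) YS] S2_abs_dot_le[OF YS assms(2)]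
    unfolding geodist_def by (auto intro!: arccos_le_pi2 simp only: abs_of_nonneg)
  ultimately show ?thesis
    using geodist_bounds[OF assms(1,2)] geodist_bounds[OF assms(1) YS]
      geodist_bounds[OF YS assms(2)]
    by - (rule cos_inj_pi; linarith)
qed

text \<open>The component of \<open>R\<close> orthogonal to \<open>P\<close> is \<open>t\<close>
  times that of \<open>Q\<close>, and \<open>sgn\<close> ignores a positive factor;
  \<open>t = 0\<close> would force \<open>R = P\<close>.\<close>

lemma unit_tangent_geodesic_arc:
  assumes "P \<in> S2" "Q \<in> S2" "R \<in> geodesic_arc P Q" "R \<noteq> P"
  shows "unit_tangent P R = unit_tangent P Q"
proof -
  obtain s t where st: "0 \<le> s" "0 \<le> t" and R: "R = s *\<^sub>R P + t *\<^sub>R Q" and RS: "R \<in> S2"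
    using assms(3) by (auto simp: geodesic_arc_def)
  have "t \<noteq> 0"
    using R RS assms(1,4) st by auto
  moreover have "R - (P \<bullet> R) *\<^sub>R P = t *\<^sub>R (Q - (P \<bullet> Q) *\<^sub>R P)"
    using S2_dot_self[OF assms(1)] by (simp add: R inner_add_right algebra_simps)
  ultimately show ?thesis
    using st by (simp add: unit_tangent_def sgn_scaleR)
qed

section \<open>Minimisers: the first-order condition and the effect of moving the vertices\<close>

text \<open>First variation: leaving \<open>P\<close> in the unit direction \<open>v\<close>, the
  distance to \<open>B\<close> changes at rate \<open>- (v \<bullet> unit_tangent P B)\<close>. With
  \<open>v\<close> along the weighted sum \<open>W\<close> of tangents, the objective has slope
  \<open>- norm W\<close> at its minimum, so \<open>W = 0\<close>. The bounds \<open>ndeg\<close>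
  make arccos differentiable there.\<close>

lemma weighted_Fermat_point_balance:
  assumes F: "weighted_Fermat_point w1 w2 w3 B1 B2 B3 P"
    and S: "B1 \<in> S2" "B2 \<in> S2" "B3 \<in> S2"
    and ndeg: "\<bar>P \<bullet> B1\<bar> < 1" "\<bar>P \<bullet> B2\<bar> < 1" "\<bar>P \<bullet> B3\<bar> < 1"
  shows "w1 *\<^sub>R unit_tangent P B1 + w2 *\<^sub>R unit_tangent P B2 + w3 *\<^sub>R unit_tangent P B3 = 0"
proof (rule ccontr)
  let ?U = "unit_tangent P"
  define W where "W = w1 *\<^sub>R ?U B1 + w2 *\<^sub>R ?U B2 + w3 *\<^sub>R ?U B3"
  assume "\<not> ?thesis"
  then have W: "W \<noteq> 0"
    by (simp add: W_def)
  define v where "v = sgn W"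
  have P: "P \<in> S2"
    using F by (simp add: weighted_Fermat_point_def is_arg_min_def)
  have PW: "P \<bullet> W = 0"
    using P by (simp add: W_def inner_add_right unit_tangent_orthogonal)
  then have Pv: "P \<bullet> v = 0"
    by (simp add: v_def sgn_div_norm)
  have vv: "v \<bullet> v = 1"
    using W by (simp add: v_def dot_square_norm norm_sgn)
  \<comment> \<open>The unit-speed great circle through \<open>P\<close> with initial velocity
    \<open>v\<close>.\<close>
  define g where "g x = cos x *\<^sub>R P + sin x *\<^sub>R v" for x :: real
  have gS: "g x \<in> S2" for x
    using S2_dot_self[OF P] vv Pv
    by (simp add: g_def norm_eq_1 inner_add_left inner_add_right inner_commute
        flip: power2_eq_square)
  \<comment> \<open>The left side is the quotient from differentiating arccos; \<open>v\<close> is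
    orthogonal to \<open>P\<close>, so it sees only the tangential part of \<open>B\<close>.\<close>
  have vB: "v \<bullet> B / sqrt (1 - (P \<bullet> B)\<^sup>2) = v \<bullet> ?U B" if "B \<in> S2" "\<bar>P \<bullet> B\<bar> < 1" for B
  proof -
    have "(P \<bullet> B)\<^sup>2 < 1"
      using that by (simp add: abs_square_less_1)
    moreover have "v \<bullet> (sin (geodist P B) *\<^sub>R ?U B) = v \<bullet> (B - (P \<bullet> B) *\<^sub>R P)"
      using unit_tangent_polar[OF P that(1)] by simp
    ultimately show ?thesis
      using Pv P that by (simp add: sin_geodist inner_diff_right inner_commute field_simps)
  qed
  have der: "((\<lambda>x. geodist (g x) B) has_real_derivative - (v \<bullet> ?U B)) (at 0)"
    if "B \<in> S2" "\<bar>P \<bullet> B\<bar> < 1" for B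
  proof -
    have "((\<lambda>x. arccos (cos x * (P \<bullet> B) + sin x * (v \<bullet> B))) has_real_derivative
        - (v \<bullet> B / sqrt (1 - (P \<bullet> B)\<^sup>2))) (at 0)"
      using that(2) by (auto intro!: derivative_eq_intros simp: abs_less_iff divide_simps)
    then show ?thesis
      using vB[OF that] by (simp add: geodist_def g_def inner_add_left)
  qed
  define h where "h x = w1 * geodist (g x) B1 + w2 * geodist (g x) B2 + w3 * geodist (g x) B3" for x
  have "(h has_real_derivative - (v \<bullet> W)) (at 0)"
    unfolding h_def W_def using S ndeg
    by (auto intro!: derivative_eq_intros der simp: inner_add_right)
  moreover have "h 0 \<le> h x" for x
    using F gS[of x] by (auto simp: weighted_Fermat_point_def is_arg_min_linorder h_def g_def)
  ultimately have "- (v \<bullet> W) = 0"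
    using DERIV_local_min[of h "- (v \<bullet> W)" 0 1] by simp
  then show False
    using W by (simp add: v_def sgn_div_norm)
qed

text \<open>\<open>Q\<close> is an arbitrary minimiser for the moved vertices. The equalities will
  place it on great circles through \<open>P\<close>; its minimality for the old vertices will
  exclude the antipode of \<open>P\<close>.\<close>

lemma weighted_Fermat_point_move_towards:
  assumes w: "w1 > 0" "w2 > 0" "w3 > 0"
    and S: "B1 \<in> S2" "B2 \<in> S2" "B3 \<in> S2" "C1 \<in> S2" "C2 \<in> S2" "C3 \<in> S2"
    and F: "weighted_Fermat_point w1 w2 w3 B1 B2 B3 P"
    and add: "geodist P B1 = geodist P C1 + geodist C1 B1"
      "geodist P B2 = geodist P C2 + geodist C2 B2"
      "geodist P B3 = geodist P C3 + geodist C3 B3"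
    and F': "weighted_Fermat_point w1 w2 w3 C1 C2 C3 Q"
  shows "weighted_Fermat_point w1 w2 w3 B1 B2 B3 Q"
    and "geodist Q B1 = geodist Q C1 + geodist C1 B1"
    and "geodist Q B2 = geodist Q C2 + geodist C2 B2"
    and "geodist Q B3 = geodist Q C3 + geodist C3 B3"
proof -
  have PS: "P \<in> S2" and QS: "Q \<in> S2"
    using F F' by (auto simp: weighted_Fermat_point_def is_arg_min_def)
  \<comment> \<open>The defects in the triangle inequalities from \<open>Q\<close> through the moved
    vertices.\<close>
  define e1 e2 e3 where "e1 = geodist Q C1 + geodist C1 B1 - geodist Q B1"
    and "e2 = geodist Q C2 + geodist C2 B2 - geodist Q B2"
    and "e3 = geodist Q C3 + geodist C3 B3 - geodist Q B3"
  note e = e1_def e2_def e3_def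
  have e0: "0 \<le> w1 * e1" "0 \<le> w2 * e2" "0 \<le> w3 * e3"
    using w geodist_triangle[OF QS S(4) S(1)] geodist_triangle[OF QS S(5) S(2)]
      geodist_triangle[OF QS S(6) S(3)] by (auto simp: e intro!: mult_nonneg_nonneg)
  have min: "w1 * geodist P B1 + w2 * geodist P B2 + w3 * geodist P B3
      \<le> w1 * geodist R B1 + w2 * geodist R B2 + w3 * geodist R B3" if "R \<in> S2" for R
    using F that by (simp add: weighted_Fermat_point_def is_arg_min_linorder)
  have "w1 * geodist Q C1 + w2 * geodist Q C2 + w3 * geodist Q C3
      \<le> w1 * geodist P C1 + w2 * geodist P C2 + w3 * geodist P C3"
    using F' PS by (simp add: weighted_Fermat_point_def is_arg_min_linorder)
  \<comment> \<open>By \<open>add\<close>, the value at \<open>P\<close> drops by exactly the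
    weighted sum of the \<open>geodist\<close> between old and new vertices. Minimality of
    \<open>P\<close> then leaves no room for positive defects.\<close>
  then have upper: "w1 * e1 + w2 * e2 + w3 * e3
      + (w1 * geodist Q B1 + w2 * geodist Q B2 + w3 * geodist Q B3)
      \<le> w1 * geodist P B1 + w2 * geodist P B2 + w3 * geodist P B3"
    by (simp add: e add algebra_simps)
  then have "w1 * e1 = 0" "w2 * e2 = 0" "w3 * e3 = 0"
    using min[OF QS] e0 by linarith+
  then have "e1 = 0" "e2 = 0" "e3 = 0"
    using w by auto
  then show "geodist Q B1 = geodist Q C1 + geodist C1 B1"
    "geodist Q B2 = geodist Q C2 + geodist C2 B2"
    "geodist Q B3 = geodist Q C3 + geodist C3 B3"
    by (simp_all add: e)
  have "w1 * geodist Q B1 + w2 * geodist Q B2 + w3 * geodist Q B3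
      \<le> w1 * geodist P B1 + w2 * geodist P B2 + w3 * geodist P B3"
    using upper e0 by linarith
  then show "weighted_Fermat_point w1 w2 w3 B1 B2 B3 Q"
    unfolding weighted_Fermat_point_def is_arg_min_linorder
    using QS min order_trans by blast
qed

section \<open>Linear independence of vertices and interiors of spherical triangles\<close>

text \<open>A nontrivial relation would put one vertex in the span of the other two; that span has
  dimension at most 2, so it has a nonzero normal, which would be orthogonal to all three
  vertices.\<close>

lemma geodesic_triangle_independent:
  assumes T: "geodesic_triangle B1 B2 B3" and eq: "r *\<^sub>R B1 + s *\<^sub>R B2 + t *\<^sub>R B3 = 0"
  shows "r = 0 \<and> s = 0 \<and> t = 0"
proof -
  have *: "k = 0" if "k *\<^sub>R X = l *\<^sub>R Y + m *\<^sub>R Z" and "{X, Y, Z} = {B1, B2, B3}"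
    for k l m X Y Z
  proof (rule ccontr)
    assume "k \<noteq> 0"
    then have "X = (l / k) *\<^sub>R Y + (m / k) *\<^sub>R Z"
      using arg_cong[OF that(1), of "\<lambda>x. inverse k *\<^sub>R x"]
      by (simp add: algebra_simps divide_inverse)
    then have X: "X \<in> span {Y, Z}"
      by (metis insert_iff span_add span_base span_scale)
    have "dim {Y, Z} \<le> card {Y, Z}"
      by (rule dim_le_card') simp
    also have "\<dots> < DIM(real^3)"
      by (simp add: card_insert_if)
    finally obtain n where n: "n \<noteq> 0" "span {Y, Z} \<subseteq> {x. n \<bullet> x = 0}"
      using lowdim_subset_hyperplane by blast
    then have "n \<bullet> X = 0" "n \<bullet> Y = 0" "n \<bullet> Z = 0"
      using X span_base[of Y "{Y, Z}"] span_base[of Z "{Y, Z}"] by auto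
    then have "\<forall>x\<in>{B1, B2, B3}. n \<bullet> x = 0"
      unfolding that(2)[symmetric] by simp
    then show False
      using T n(1) by (auto simp: geodesic_triangle_def)
  qed
  have "r *\<^sub>R B1 = (- s) *\<^sub>R B2 + (- t) *\<^sub>R B3" "s *\<^sub>R B2 = (- r) *\<^sub>R B1 + (- t) *\<^sub>R B3"
    "t *\<^sub>R B3 = (- r) *\<^sub>R B1 + (- s) *\<^sub>R B2"
    using eq by (simp_all add: algebra_simps eq_neg_iff_add_eq_0)
  from *[OF this(1)] *[OF this(2)] *[OF this(3)] show ?thesis
    by (auto simp: insert_commute)
qed

text \<open>Coefficients with respect to independent vertices are unique, so positive ones keep
  \<open>P\<close> off the sides, where some coefficient is 0.\<close>

lemma triangle_interiorI:
  assumes T: "geodesic_triangle B1 B2 B3" and PS: "P \<in> S2"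
    and P: "k *\<^sub>R P = r *\<^sub>R B1 + s *\<^sub>R B2 + t *\<^sub>R B3" and pos: "0 < k" "0 < r" "0 < s" "0 < t"
  shows "P \<in> triangle_interior B1 B2 B3"
proof -
  have P': "P = (r / k) *\<^sub>R B1 + (s / k) *\<^sub>R B2 + (t / k) *\<^sub>R B3"
    using arg_cong[OF P, of "\<lambda>x. inverse k *\<^sub>R x"] pos(1)
    by (simp add: algebra_simps divide_inverse)
  have "P \<in> triangle_region B1 B2 B3"
    unfolding triangle_region_def using P' PS pos
    by (intro IntI CollectI exI[of _ "r / k"] exI[of _ "s / k"] exI[of _ "t / k"]) auto
  moreover have False if "P = x *\<^sub>R B1 + y *\<^sub>R B2 + z *\<^sub>R B3" "x = 0 \<or> y = 0 \<or> z = 0" for x y z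
  proof -
    have "(r / k - x) *\<^sub>R B1 + (s / k - y) *\<^sub>R B2 + (t / k - z) *\<^sub>R B3 = P - P"
      by (subst (1) P', subst that(1)) (simp add: algebra_simps)
    then show False
      using geodesic_triangle_independent[OF T] that(2) pos by fastforce
  qed
  note off = this
  have "P \<noteq> x *\<^sub>R B1 + y *\<^sub>R B2" "P \<noteq> x *\<^sub>R B2 + y *\<^sub>R B3" "P \<noteq> x *\<^sub>R B1 + y *\<^sub>R B3" for x y
    using off[of x y 0] off[of 0 x y] off[of x 0 y] by auto
  then have "P \<notin> geodesic_arc B1 B2" "P \<notin> geodesic_arc B2 B3" "P \<notin> geodesic_arc B1 B3"
    unfolding geodesic_arc_def by blast+
  ultimately show ?thesis
    by (simp add: triangle_interior_def)
qed

lemma triangle_interior_pos: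
  assumes "P \<in> triangle_interior B1 B2 B3"
  obtains r s t where "0 < r" "0 < s" "0 < t" "P = r *\<^sub>R B1 + s *\<^sub>R B2 + t *\<^sub>R B3"
proof -
  obtain r s t where nn: "0 \<le> r" "0 \<le> s" "0 \<le> t" and P: "P = r *\<^sub>R B1 + s *\<^sub>R B2 + t *\<^sub>R B3"
    and PS: "P \<in> S2"
    using assms by (auto simp: triangle_interior_def triangle_region_def)
  have "P \<notin> geodesic_arc B1 B2" "P \<notin> geodesic_arc B2 B3" "P \<notin> geodesic_arc B1 B3"
    using assms by (auto simp: triangle_interior_def)
  moreover have "x *\<^sub>R Y + y *\<^sub>R Z \<in> geodesic_arc Y Z"
    if "0 \<le> x" "0 \<le> y" "x *\<^sub>R Y + y *\<^sub>R Z \<in> S2" for x y Y Z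
    using that unfolding geodesic_arc_def by blast
  ultimately have "r \<noteq> 0" "s \<noteq> 0" "t \<noteq> 0"
    using nn P PS by (metis add_0 add_0_right scale_zero_left)+
  with nn P that show ?thesis
    by (simp add: less_le)
qed

section \<open>Vector identities for the balance condition and for proportionality\<close>

text \<open>The scaled vectors close up to a Euclidean triangle with sides \<open>x\<close>,
  \<open>y\<close>, \<open>z\<close>; the formula is the cosine of an exterior angle. With weights
  as sides it yields the fractions in the theorem.\<close>

lemma inner_eq_of_triangle_sides:
  fixes X Y Z :: "'a::real_inner"
  assumes "x *\<^sub>R X + y *\<^sub>R Y + z *\<^sub>R Z = 0" "norm X = 1" "norm Y = 1" "norm Z = 1" "0 < x" "0 < y"
  shows "X \<bullet> Y = (z\<^sup>2 - x\<^sup>2 - y\<^sup>2) / (2 * x * y)"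
proof -
  have "x *\<^sub>R X + y *\<^sub>R Y = - (z *\<^sub>R Z)"
    using assms(1) by (simp add: eq_neg_iff_add_eq_0)
  then have "(x *\<^sub>R X + y *\<^sub>R Y) \<bullet> (x *\<^sub>R X + y *\<^sub>R Y) = (z *\<^sub>R Z) \<bullet> (z *\<^sub>R Z)"
    by simp
  then have "x\<^sup>2 + y\<^sup>2 + 2 * x * y * (X \<bullet> Y) = z\<^sup>2"
    using assms(2-4)
    by (simp add: inner_add_left inner_add_right inner_commute power2_eq_square norm_eq_1
        algebra_simps)
  then show ?thesis
    using assms(5,6) by (simp add: field_simps)
qed

lemma norm_eq_of_balance:
  fixes X V :: "'a::real_normed_vector"
  assumes "x *\<^sub>R X + V = 0" "norm X = 1" "0 < x"
  shows "norm V = x"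
proof -
  have "V = - (x *\<^sub>R X)"
    using assms(1) by (simp add: eq_neg_iff_add_eq_0 add.commute)
  then show ?thesis
    using assms(2,3) by simp
qed

text \<open>Each equation says that \<open>Q\<close> lies in the plane of \<open>P\<close> and one
  coordinate axis. As \<open>P\<close> has positive coordinates, two such planes meet only in the
  line of \<open>P\<close>.\<close>

lemma proportional_components:
  fixes P Q :: "real^3"
  assumes pos: "0 < P$1" "0 < P$2" "0 < P$3"
    and two: "Q$2 * P$3 = Q$3 * P$2 \<and> Q$1 * P$3 = Q$3 * P$1 \<or>
      Q$2 * P$3 = Q$3 * P$2 \<and> Q$1 * P$2 = Q$2 * P$1 \<or>
      Q$1 * P$3 = Q$3 * P$1 \<and> Q$1 * P$2 = Q$2 * P$1"
  obtains k where "Q = k *\<^sub>R P"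
proof -
  have cancel: "q * p' = q' * p" if "q * z = x * p" "q' * z = x * p'" "0 < z"
    for p p' q q' x z :: real
  proof -
    have "(q * p') * z = (q' * p) * z"
      using that(1,2) by algebra
    then show ?thesis
      using that(3) by simp
  qed
  have "Q$1 * P$2 = Q$2 * P$1 \<and> Q$1 * P$3 = Q$3 * P$1"
    using two
  proof (elim disjE conjE)
    assume "Q$2 * P$3 = Q$3 * P$2" "Q$1 * P$3 = Q$3 * P$1"
    then show ?thesis
      using cancel pos by blast
  next
    assume "Q$2 * P$3 = Q$3 * P$2" "Q$1 * P$2 = Q$2 * P$1"
    then show ?thesis
      using cancel[of "Q$1" "P$2" "Q$2" "P$1" "Q$3" "P$3"] pos by simp
  qed blast
  then have "Q = (Q$1 / P$1) *\<^sub>R P"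
    using pos by (simp add: vec_eq_iff forall_3 field_simps)
  then show ?thesis
    by (rule that)
qed

section \<open>The octant triangle with vertices moved towards its minimiser\<close>

theorem proposition4:
  fixes A1 A2 A3 A0 A1' A2' A3' A0' :: "real^3"
    and w1 w2 w3 a01 a02 a03 a12' a23' a13' a b c :: real
  assumes "A1 = vector [1, 0, 0]" "A2 = vector [0, 1, 0]" "A3 = vector [0, 0, 1]"
    and "w1 > 0" "w2 > 0" "w3 > 0"
    and "weighted_Fermat_Torricelli_point w1 w2 w3 A1 A2 A3 A0"
    and "A1' \<in> geodesic_arc A0 A1" "A2' \<in> geodesic_arc A0 A2" "A3' \<in> geodesic_arc A0 A3"
    and "geodesic_triangle A1' A2' A3'"
    and "geodist A1' A2' < pi / 2" "geodist A2' A3' < pi / 2" "geodist A1' A3' < pi / 2"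
    and "floating_case w1 w2 w3 A1' A2' A3'"
    and "weighted_Fermat_point w1 w2 w3 A1' A2' A3' A0'"
    and "a01 = geodist A0 A1" "a02 = geodist A0 A2" "a03 = geodist A0 A3"
    and "a12' = geodist A1' A2'" "a23' = geodist A2' A3'" "a13' = geodist A1' A3'"
    and "a = geodist A1 A1'" "b = geodist A2 A2'" "c = geodist A3 A3'"
  shows "weighted_Fermat_Torricelli_point w1 w2 w3 A1' A2' A3' A0' \<and> A0' = A0 \<and>
    cos a12' = cos (a01 - a) * cos (a02 - b)
      + sin (a01 - a) * sin (a02 - b) * ((w3\<^sup>2 - w1\<^sup>2 - w2\<^sup>2) / (2 * w1 * w2)) \<and>
    cos a23' = cos (a02 - b) * cos (a03 - c)
      + sin (a02 - b) * sin (a03 - c) * ((w1\<^sup>2 - w2\<^sup>2 - w3\<^sup>2) / (2 * w2 * w3)) \<and>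
    cos a13' = cos (a01 - a) * cos (a03 - c)
      + sin (a01 - a) * sin (a03 - c) * ((w2\<^sup>2 - w1\<^sup>2 - w3\<^sup>2) / (2 * w1 * w3))"
proof -
  note A = assms(1-3) and w = assms(4-6) and arcs = assms(8-10) and T = assms(11)
    and short = assms(12-14) and F' = assms(16)
  have F: "weighted_Fermat_point w1 w2 w3 A1 A2 A3 A0" and int: "A0 \<in> triangle_interior A1 A2 A3"
    using assms(7) by (auto simp: weighted_Fermat_Torricelli_point_def)
  have P: "A0 \<in> S2" and Q: "A0' \<in> S2"
    using F F' by (auto simp: weighted_Fermat_point_def is_arg_min_def)
  have inA: "X \<bullet> A1 = X$1" "X \<bullet> A2 = X$2" "X \<bullet> A3 = X$3" for X
    by (simp_all add: A inner_vec_def sum_3)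
  have AS: "A1 \<in> S2" "A2 \<in> S2" "A3 \<in> S2"
    by (simp_all add: norm_eq_1 inA) (simp_all add: A)
  have AS': "A1' \<in> S2" "A2' \<in> S2" "A3' \<in> S2"
    using arcs by (auto simp: geodesic_arc_def)
  obtain r s t where rst: "0 < r" "0 < s" "0 < t" and A0: "A0 = r *\<^sub>R A1 + s *\<^sub>R A2 + t *\<^sub>R A3"
    using triangle_interior_pos[OF int] .
  have pos: "0 < A0$1" "0 < A0$2" "0 < A0$3"
    using rst by (simp_all add: A0 A)
  \<comment> \<open>Positive coordinates with squares summing to 1 are all below 1, so
    \<open>A0\<close> is neither a vertex nor antipodal to one.\<close>
  have "(A0$1)\<^sup>2 + (A0$2)\<^sup>2 + (A0$3)\<^sup>2 = 1"
    using S2_dot_self[OF P] by (simp add: inner_vec_def sum_3 power2_eq_square)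
  then have "(A0$1)\<^sup>2 < 1" "(A0$2)\<^sup>2 < 1" "(A0$3)\<^sup>2 < 1"
    using pos by (smt (verit) zero_less_power)+
  then have ndeg: "\<bar>A0 \<bullet> A1\<bar> < 1" "\<bar>A0 \<bullet> A2\<bar> < 1" "\<bar>A0 \<bullet> A3\<bar> < 1"
    by (simp_all add: inA abs_square_less_1)
  let ?U1 = "unit_tangent A0 A1" and ?U2 = "unit_tangent A0 A2" and ?U3 = "unit_tangent A0 A3"
  note bal = weighted_Fermat_point_balance[OF F AS ndeg]
  have bal': "w1 *\<^sub>R ?U1 + (w2 *\<^sub>R ?U2 + w3 *\<^sub>R ?U3) = 0" "w2 *\<^sub>R ?U2 + (w1 *\<^sub>R ?U1 + w3 *\<^sub>R ?U3) = 0"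
    "w3 *\<^sub>R ?U3 + (w1 *\<^sub>R ?U1 + w2 *\<^sub>R ?U2) = 0" "w2 *\<^sub>R ?U2 + w3 *\<^sub>R ?U3 + w1 *\<^sub>R ?U1 = 0"
    "w1 *\<^sub>R ?U1 + w3 *\<^sub>R ?U3 + w2 *\<^sub>R ?U2 = 0"
    using bal by (simp_all only: add_ac)
  note unit = norm_unit_tangent[OF P AS(1) ndeg(1)] norm_unit_tangent[OF P AS(2) ndeg(2)]
    norm_unit_tangent[OF P AS(3) ndeg(3)]
  have acute: "0 \<le> A0 \<bullet> A1" "0 \<le> A0 \<bullet> A2" "0 \<le> A0 \<bullet> A3"
    using pos by (simp_all add: inA)
  note add = geodesic_arc_geodist_add[OF P AS(1) acute(1) arcs(1)]
    geodesic_arc_geodist_add[OF P AS(2) acute(2) arcs(2)]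
    geodesic_arc_geodist_add[OF P AS(3) acute(3) arcs(3)]
  note tan = unit_tangent_geodesic_arc[OF P AS(1) arcs(1)]
    unit_tangent_geodesic_arc[OF P AS(2) arcs(2)] unit_tangent_geodesic_arc[OF P AS(3) arcs(3)]

  have distinct: "A1' \<noteq> A2'" "A1' \<noteq> A3'" "A2' \<noteq> A3'"
    using geodesic_triangle_independent[OF T, of 1 "-1" 0]
      geodesic_triangle_independent[OF T, of 1 0 "-1"]
      geodesic_triangle_independent[OF T, of 0 1 "-1"] by auto
  \<comment> \<open>At \<open>A0\<close> the balance condition turns the floating inequalities into
    equalities. If a moved vertex were \<open>A0\<close>, the tangents there to the other two, which
    differ from \<open>A0\<close>, would be the original ones, and its inequality would read
    \<open>w < w\<close> for its own weight.\<close>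
  have "norm (w2 *\<^sub>R unit_tangent A0 A2 + w3 *\<^sub>R unit_tangent A0 A3) = w1"
    "norm (w1 *\<^sub>R unit_tangent A0 A1 + w3 *\<^sub>R unit_tangent A0 A3) = w2"
    "norm (w1 *\<^sub>R unit_tangent A0 A1 + w2 *\<^sub>R unit_tangent A0 A2) = w3"
    using norm_eq_of_balance[OF _ unit(1) w(1)] norm_eq_of_balance[OF _ unit(2) w(2)]
      norm_eq_of_balance[OF _ unit(3) w(3)] bal' by blast+
  then have ne: "A1' \<noteq> A0" "A2' \<noteq> A0" "A3' \<noteq> A0"
    using assms(15) distinct tan unfolding floating_case_def by (metis less_irrefl)+
  note tan = tan(1)[OF ne(1)] tan(2)[OF ne(2)] tan(3)[OF ne(3)]

  note move = weighted_Fermat_point_move_towards[OF w AS AS' F add F']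
  have circle: "\<exists>u v. A0' = u *\<^sub>R A0 + v *\<^sub>R B"
    if B: "B \<in> S2" "B' \<in> geodesic_arc A0 B" "0 \<le> A0 \<bullet> B" "B' \<noteq> B"
      "geodist A0' B = geodist A0' B' + geodist B' B" for B B'
  proof -
    obtain x y where xy: "0 \<le> x" "0 \<le> y" "B' = x *\<^sub>R A0 + y *\<^sub>R B" and BS': "B' \<in> S2"
      using B(2) by (auto simp: geodesic_arc_def)
    \<comment> \<open>Rules out \<open>B' = -B\<close>. Together with \<open>B' \<noteq> B\<close>
      this makes the great circle through \<open>B'\<close> and \<open>B\<close> unique; it is the
      one through \<open>A0\<close> and \<open>B\<close>.\<close>
    have "0 \<le> B' \<bullet> B"
      using xy B(3) S2_dot_self[OF B(1)] by (simp add: inner_add_left)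
    moreover have "B' \<bullet> B \<noteq> 1"
    proof
      assume "B' \<bullet> B = 1"
      then have "(B' - B) \<bullet> (B' - B) = 0"
        using S2_dot_self[OF B(1)] S2_dot_self[OF BS']
        by (simp add: inner_diff_left inner_diff_right inner_commute)
      then show False
        using B(4) by simp
    qed
    ultimately have "\<bar>B' \<bullet> B\<bar> < 1"
      using S2_abs_dot_le[OF BS' B(1)] by linarith
    then obtain u v where "A0' = u *\<^sub>R B' + v *\<^sub>R B"
      using geodist_triangle_equality[OF Q BS' B(1) B(5)] by blast
    then have "A0' = (u * x) *\<^sub>R A0 + (u * y + v) *\<^sub>R B"
      by (simp add: xy(3) algebra_simps)
    then show ?thesis
      by blast
  qed
  \<comment> \<open>Two unmoved vertices would be at distance exactly \<open>pi / 2\<close>, so at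
    least two vertices have moved.\<close>
  have "A1' = A1 \<Longrightarrow> A2' = A2 \<Longrightarrow> False" "A2' = A2 \<Longrightarrow> A3' = A3 \<Longrightarrow> False"
    "A1' = A1 \<Longrightarrow> A3' = A3 \<Longrightarrow> False"
    using short by (auto simp: geodist_def inA) (simp_all add: A)
  \<comment> \<open>Adding a multiple of a coordinate vector changes one coordinate and leaves the
    other two proportional to those of \<open>A0\<close>.\<close>
  moreover have "Q$2 * A0$3 = Q$3 * A0$2" if "Q = u *\<^sub>R A0 + v *\<^sub>R A1" for Q u v
    by (simp add: that A)
  moreover have "Q$1 * A0$3 = Q$3 * A0$1" if "Q = u *\<^sub>R A0 + v *\<^sub>R A2" for Q u v
    by (simp add: that A)
  moreover have "Q$1 * A0$2 = Q$2 * A0$1" if "Q = u *\<^sub>R A0 + v *\<^sub>R A3" for Q u v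
    by (simp add: that A)
  ultimately obtain k where k: "A0' = k *\<^sub>R A0"
    using circle[OF AS(1) arcs(1) acute(1) _ move(2)] circle[OF AS(2) arcs(2) acute(2) _ move(3)]
      circle[OF AS(3) arcs(3) acute(3) _ move(4)] proportional_components[OF pos, of A0']
    by metis
  have "\<bar>k\<bar> = 1"
    using k P Q by simp
  \<comment> \<open>Since \<open>A0\<close> has positive coordinates, its antipode is strictly
    farther from every original vertex, against \<open>move(1)\<close>.\<close>
  moreover have "k \<noteq> -1"
  proof
    assume "k = -1"
    moreover have "arccos x < arccos (- x)" if "0 < x" "\<bar>x\<bar> < 1" for x
      using that by (intro arccos_less_arccos) auto
    ultimately have "geodist A0 A1 < geodist A0' A1" "geodist A0 A2 < geodist A0' A2"
        "geodist A0 A3 < geodist A0' A3"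
      using k pos ndeg by (simp_all add: geodist_def inA)
    then have "w1 * geodist A0 A1 + w2 * geodist A0 A2 + w3 * geodist A0 A3
        < w1 * geodist A0' A1 + w2 * geodist A0' A2 + w3 * geodist A0' A3"
      using w by (intro add_strict_mono mult_strict_left_mono)
    then show False
      using move(1) P by (auto simp: weighted_Fermat_point_def is_arg_min_def)
  qed
  ultimately have same: "A0' = A0"
    using k by (simp add: abs_if split: if_splits)

  \<comment> \<open>Solves the arc representation for the original vertex, so that \<open>A0\<close>
    can be expanded in the moved vertices.\<close>
  have scale: "\<exists>x y. 0 \<le> x \<and> 0 < y \<and> B = y *\<^sub>R B' - x *\<^sub>R A0"
    if B: "B' \<in> geodesic_arc A0 B" "B' \<noteq> A0" for B B'
  proof -
    obtain x y where xy: "0 \<le> x" "0 \<le> y" "B' = x *\<^sub>R A0 + y *\<^sub>R B" and BS': "B' \<in> S2"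
      using B(1) by (auto simp: geodesic_arc_def)
    have "y \<noteq> 0"
      using xy BS' P B(2) by auto
    then have "B = (1 / y) *\<^sub>R B' - (x / y) *\<^sub>R A0"
      by (simp add: xy(3) algebra_simps)
    then show ?thesis
      using xy \<open>y \<noteq> 0\<close> by (metis divide_nonneg_nonneg less_le zero_less_divide_1_iff)
  qed
  obtain x1 y1 x2 y2 x3 y3 where nn: "0 \<le> x1" "0 < y1" "0 \<le> x2" "0 < y2" "0 \<le> x3" "0 < y3"
    and B: "A1 = y1 *\<^sub>R A1' - x1 *\<^sub>R A0" "A2 = y2 *\<^sub>R A2' - x2 *\<^sub>R A0"
      "A3 = y3 *\<^sub>R A3' - x3 *\<^sub>R A0"
    using scale[OF arcs(1) ne(1)] scale[OF arcs(2) ne(2)] scale[OF arcs(3) ne(3)] by blast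
  \<comment> \<open>All multiples of \<open>A0\<close> are collected on the left; the moved vertices
    keep positive coefficients.\<close>
  have "(1 + r * x1 + s * x2 + t * x3) *\<^sub>R A0
      = A0 + (r * x1) *\<^sub>R A0 + (s * x2) *\<^sub>R A0 + (t * x3) *\<^sub>R A0"
    by (simp add: algebra_simps)
  also have "\<dots> = r *\<^sub>R (A1 + x1 *\<^sub>R A0) + s *\<^sub>R (A2 + x2 *\<^sub>R A0) + t *\<^sub>R (A3 + x3 *\<^sub>R A0)"
    by (subst (1) A0) (simp add: algebra_simps)
  also have "\<dots> = (r * y1) *\<^sub>R A1' + (s * y2) *\<^sub>R A2' + (t * y3) *\<^sub>R A3'"
    unfolding B by simp
  finally have "A0 \<in> triangle_interior A1' A2' A3'"
    by (rule triangle_interiorI[OF T P]) (use nn rst in \<open>simp_all add: add_pos_nonneg\<close>)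
  then have "weighted_Fermat_Torricelli_point w1 w2 w3 A1' A2' A3' A0'"
    using F' same by (simp add: weighted_Fermat_Torricelli_point_def)
  moreover have "a01 - a = geodist A0 A1'" "a02 - b = geodist A0 A2'" "a03 - c = geodist A0 A3'"
    using add assms(17-19,23-25) by (simp_all add: geodist_commute)
  \<comment> \<open>By \<open>tan\<close> the directions from \<open>A0\<close> are those of the
    original vertices, so the balance condition fixes the angles.\<close>
  moreover have
    "unit_tangent A0 A1' \<bullet> unit_tangent A0 A2' = (w3\<^sup>2 - w1\<^sup>2 - w2\<^sup>2) / (2 * w1 * w2)"
    "unit_tangent A0 A2' \<bullet> unit_tangent A0 A3' = (w1\<^sup>2 - w2\<^sup>2 - w3\<^sup>2) / (2 * w2 * w3)"
    "unit_tangent A0 A1' \<bullet> unit_tangent A0 A3' = (w2\<^sup>2 - w1\<^sup>2 - w3\<^sup>2) / (2 * w1 * w3)"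
    unfolding tan
    using inner_eq_of_triangle_sides[OF bal unit(1,2,3) w(1,2)]
      inner_eq_of_triangle_sides[OF bal'(4) unit(2,3,1) w(2,3)]
      inner_eq_of_triangle_sides[OF bal'(5) unit(1,3,2) w(1,3)] by blast+
  ultimately show ?thesis
    unfolding assms(20-22) cos_geodist[OF AS'(1,2)] cos_geodist[OF AS'(2,3)]
      cos_geodist[OF AS'(1,3)] spherical_law_of_cosines[OF AS'(1) P AS'(2)]
      spherical_law_of_cosines[OF AS'(2) P AS'(3)] spherical_law_of_cosines[OF AS'(1) P AS'(3)]
    using same by simp
qed

end
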